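(* Let $\lambda$ be a nonzero real number, let $p(x)\in\mathbb{C}[x]$ with $\deg p(x)=n$, and let $f(t)=\frac{1}{\lambda}(e^{\lambda t}-1)$. Then $p(x)=\sum_{k=0}^{n}a_k\,\mathcal{E}_{k,\lambda}(x)$, where for $k=0,1,\dots,n$, \begin{align*} a_k&=\frac{1}{2\,k!}\,(f(t))^{k}\big(p(x+1)+p(x)\big)\Big|_{x=0} =\frac{1}{2\,k!\,\lambda^{k}}\big\langle (e^{\lambda t}-1)^{k}\,\big|\, p(x+1)+p(x)\big\rangle\\ &=\frac{1}{2\,k!\,\lambda^{k}}\Delta_{\lambda}^{k}\tilde{\Delta}p(0) =\frac{1}{2\,k!\,\lambda^{k}}\sum_{j=0}^{k}\binom{k}{j}(-1)^{k-j}\big(p(1+j\lambda)+p(j\lambda)\big)\\ &=\frac{1}{2}\sum_{l=k}^{n}S_2(l,k)\frac{\lambda^{l-k}}{l!}\big(p^{(l)}(1)+p^{(l)}(0)\big). \end{align*}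
   Context: The degenerate exponential is $e_\lambda^x(t)=(1+\lambda t)^{x/\lambda}$, $e_\lambda(t)=e_\lambda^1(t)$. The degenerate Euler polynomials $\mathcal{E}_{n,\lambda}(x)$ are defined by $\frac{2}{e_\lambda(t)+1}e_\lambda^x(t)=\sum_{n\ge0}\mathcal{E}_{n,\lambda}(x)\frac{t^n}{n!}$. A formal power series $F(t)$ acts on polynomials as a differential operator via $t^k x^m=(m)_k x^{m-k}$ (so $e^{yt}q(x)=q(x+y)$), and as a linear functional via $\langle F(t)|q(x)\rangle=(F(t)q(x))|_{x=0}$. For a polynomial $q$: $\Delta_\lambda^k q(x)=\sum_{i=0}^k\binom{k}{i}(-1)^{k-i}q(x+i\lambda)$, $\tilde{\Delta}q(x)=q(x+1)+q(x)$, and $\Delta_\lambda^k\tilde\Delta p(0)$ is $(\Delta_\lambda^k\tilde\Delta p)(0)$. $p^{(l)}$ is the $l$-th derivative; $S_2(l,k)$ are Stirling numbers of the second kind, $\frac{1}{k!}(e^t-1)^k=\sum_{l\ge k}S_2(l,k)\frac{t^l}{l!}$. *)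

theory Defs
  imports
    Complex_Main
    "HOL-Computational_Algebra.Polynomial"
    "HOL-Computational_Algebra.Formal_Power_Series"
    "HOL-Combinatorics.Stirling"
begin

text \<open>
  The formal power series \<open>(1 + lam t)\<^bsup>x/lam\<^esup>\<close> in \<open>t\<close>. It is meaningful only for \<open>lam \<noteq> 0\<close>, since
  \<open>x / 0 = 0\<close> in HOL.
\<close>

definition degenerate_exp :: "real \<Rightarrow> complex \<Rightarrow> complex fps" where
  "degenerate_exp lam x =
     fps_compose (fps_binomial (x / of_real lam)) (fps_const (of_real lam) * fps_X)"

definition degenerate_Euler_fps :: "real \<Rightarrow> complex \<Rightarrow> complex fps" where
  "degenerate_Euler_fps lam x = 2 / (degenerate_exp lam 1 + 1) * degenerate_exp lam x"

text \<open>
  The definition selects the polynomial in \<open>x\<close> with the prescribed values; the lemma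
  \<open>poly_degenerate_Euler\<close> below shows that it exists, and it is unique because a complex
  polynomial is determined by its values.
\<close>

definition degenerate_Euler :: "nat \<Rightarrow> real \<Rightarrow> complex poly" where
  "degenerate_Euler n lam =
     (THE q. \<forall>x. poly q x = fact n * fps_nth (degenerate_Euler_fps lam x) n)"

lemma degenerate_exp_nth:
  "fps_nth (degenerate_exp lam x) n = of_real lam ^ n * ((x / of_real lam) gchoose n)"
  by (simp add: degenerate_exp_def fps_nth_compose_linear)

lemma poly_degenerate_Euler:
  "poly (degenerate_Euler n lam) x = fact n * fps_nth (degenerate_Euler_fps lam x) n"
proof -
  define c where "c = 2 / (degenerate_exp lam 1 + 1)"
  define B :: "nat \<Rightarrow> complex poly" where
    "B m = smult (of_real lam ^ m / fact m) (\<Prod>i<m. [:- of_nat i, 1 / of_real lam:])" for m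
  have B: "poly (B m) y = fps_nth (degenerate_exp lam y) m" for m y
    by (simp add: B_def degenerate_exp_nth gbinomial_prod_rev poly_prod atLeast0LessThan)
  define q where "q = smult (fact n) (\<Sum>i=0..n. smult (fps_nth c i) (B (n - i)))"
  have q: "\<forall>y. poly q y = fact n * fps_nth (degenerate_Euler_fps lam y) n"
    by (simp add: q_def degenerate_Euler_fps_def flip: c_def)
       (simp add: fps_mult_nth poly_sum B)
  have "degenerate_Euler n lam = q"
    unfolding degenerate_Euler_def
  proof (rule the_equality[where a = q])
    show "\<forall>y. poly q y = fact n * fps_nth (degenerate_Euler_fps lam y) n" by (rule q)
  next
    fix r assume "\<forall>y. poly r y = fact n * fps_nth (degenerate_Euler_fps lam y) n"
    with q have "poly r = poly q" by auto
    thus "r = q" by (simp add: poly_eq_poly_eq_iff)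
  qed
  with q show ?thesis by simp
qed

lemma degenerate_Euler_generating_function:
  "2 / (degenerate_exp lam 1 + 1) * degenerate_exp lam x =
     Abs_fps (\<lambda>n. poly (degenerate_Euler n lam) x / fact n)"
  by (simp add: fps_eq_iff poly_degenerate_Euler flip: degenerate_Euler_fps_def)

text \<open>
  The series \<open>F(t)\<close> acts by substituting \<open>d/dx\<close> for \<open>t\<close>; the terms of order above the degree
  of the polynomial vanish. The coefficient of \<open>t\<^sup>k\<close> is \<open>fps_nth F k\<close>, with no factor \<open>1/k!\<close>.
\<close>

definition fps_act :: "complex fps \<Rightarrow> complex poly \<Rightarrow> complex poly" where
  "fps_act F q = (\<Sum>k\<le>degree q. smult (fps_nth F k) ((pderiv ^^ k) q))"

definition fps_functional :: "complex fps \<Rightarrow> complex poly \<Rightarrow> complex" where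
  "fps_functional F q = poly (fps_act F q) 0"

definition shift_poly :: "complex \<Rightarrow> complex poly \<Rightarrow> complex poly" where
  "shift_poly y q = pcompose q [:y, 1:]"

lemma poly_shift_poly: "poly (shift_poly y q) x = poly q (x + y)"
  by (simp add: shift_poly_def poly_pcompose add.commute)

lemma higher_pderiv_monom_falling:
  "(pderiv ^^ k) (monom (1 :: complex) m) =
     (if k \<le> m then smult (\<Prod>i<k. of_nat (m - i)) (monom 1 (m - k)) else 0)"
proof (induction k)
  case (Suc k)
  show ?case
  proof (cases "Suc k \<le> m")
    case True
    thus ?thesis
      by (simp add: Suc.IH pderiv_smult pderiv_monom smult_monom mult.commute)
  next
    case False
    thus ?thesis
      using Suc.IH by (cases "k = m") (auto simp: pderiv_smult pderiv_monom)
  qed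
qed simp

lemma fps_act_X_power_monom:
  "fps_act (fps_X ^ k) (monom 1 m) =
     (if k \<le> m then smult (\<Prod>i<k. of_nat (m - i)) (monom 1 (m - k)) else 0)"
proof -
  have "fps_act (fps_X ^ k) (monom 1 m) =
      (\<Sum>j\<le>m. if j = k then (pderiv ^^ k) (monom 1 m) else 0)"
    unfolding fps_act_def by (intro sum.cong) (auto simp: degree_monom_eq)
  also have "\<dots> = (if k \<le> m then (pderiv ^^ k) (monom 1 m) else 0)"
    by simp
  finally show ?thesis
    by (simp add: higher_pderiv_monom_falling)
qed

definition Delta :: "real \<Rightarrow> nat \<Rightarrow> complex poly \<Rightarrow> complex poly" where
  "Delta lam k q =
     (\<Sum>i=0..k. smult (of_nat (k choose i) * (-1) ^ (k - i))
       (shift_poly (of_nat i * of_real lam) q))"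

definition Delta_tilde :: "complex poly \<Rightarrow> complex poly" where
  "Delta_tilde q = shift_poly 1 q + q"

text \<open>
  The Stirling numbers of the second kind are those of the library, which are defined by
  recursion; they have the usual exponential generating function.
\<close>

lemma Stirling_generating_function:
  "fps_const (1 / fact k) * (fps_exp 1 - 1) ^ k =
     Abs_fps (\<lambda>l. of_nat (Stirling l k) / fact l :: complex)"
proof -
  define G :: "nat \<Rightarrow> complex fps" where "G k = fps_const (1 / fact k) * (fps_exp 1 - 1) ^ k" for k
  have deriv: "fps_deriv (G (Suc k)) = of_nat (Suc k) * G (Suc k) + G k" for k
  proof -
    have "1 / fact k = of_nat (Suc k) * (1 / fact (Suc k) :: complex)"
      by (simp add: fact_Suc del: of_nat_Suc)
    hence c: "fps_const (1 / fact k) = of_nat (Suc k) * fps_const (1 / fact (Suc k) :: complex)"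
      by (metis fps_const_mult fps_of_nat)
    have d: "fps_deriv ((fps_exp 1 - 1 :: complex fps) ^ Suc k) =
            of_nat (Suc k) * fps_exp 1 * (fps_exp 1 - 1) ^ k"
      by (simp add: fps_deriv_power' del: power_Suc of_nat_Suc)
    show ?thesis
      unfolding G_def c fps_deriv_mult_const_left d
      by (simp add: algebra_simps del: fact_Suc of_nat_Suc)
  qed
  have "fps_nth (G k) l = of_nat (Stirling l k) / fact l" for l
  proof (induction l arbitrary: k)
    case 0
    show ?case by (cases k) (simp_all add: G_def)
  next
    case (Suc l)
    note IH = Suc.IH
    show ?case
    proof (cases k)
      case 0
      thus ?thesis by (simp add: G_def)
    next
      case (Suc m)
      have "of_nat (Suc l) * fps_nth (G (Suc m)) (Suc l) = fps_nth (fps_deriv (G (Suc m))) l"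
        by simp
      also have "\<dots> = of_nat (Suc m) * fps_nth (G (Suc m)) l + fps_nth (G m) l"
        unfolding deriv by (simp flip: fps_of_nat del: of_nat_Suc)
      also have "\<dots> = of_nat (Stirling (Suc l) (Suc m)) / fact l"
        by (simp add: IH add_divide_distrib ring_distribs)
      finally show ?thesis
        unfolding Suc by (simp add: field_simps del: of_nat_Suc Stirling.simps)
    qed
  qed
  thus ?thesis by (simp add: fps_eq_iff G_def)
qed

end

theory Submission
  imports Defs
begin

text \<open>
  The operator \<open>q(x) \<mapsto> q(x + 1) + q(x)\<close> is injective on polynomials, because it doubles the leading
  coefficient, and the generating function shows that it sends \<open>\<E>\<^sub>k\<close> to \<open>2 k! lam\<^sup>k\<close> times the
  binomial coefficient \<open>x/lam\<close> over \<open>k\<close>. It therefore suffices to expand \<open>q = p(x + 1) + p(x)\<close> in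
  these binomial coefficients. At \<open>x = m lam\<close> this is the functional of the binomial expansion of
  \<open>e\<^bsup>m lam t\<^esup> = (1 + (e\<^bsup>lam t\<^esup> - 1))\<^sup>m\<close> applied to \<open>q\<close>, truncated at \<open>n\<close> since
  \<open>(e\<^bsup>lam t\<^esup> - 1)\<^sup>k\<close> has no terms below \<open>t\<^sup>k\<close>; agreement at infinitely many points is enough.
\<close>

text \<open>The \<open>k\<close>-th derivative of \<open>q\<close> at 0 is
  \<open>fact k * coeff q k\<close>. The bound \<open>N\<close> is left free so that the sum can
  later run to \<open>n\<close> instead of \<open>degree q\<close>.\<close>

lemma fps_functional_eq_coeff_sum:
  assumes "degree q \<le> N"
  shows "fps_functional F q = (\<Sum>k\<le>N. fact k * fps_nth F k * coeff q k)"
proof -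
  have "fps_functional F q = (\<Sum>k\<le>degree q. fact k * fps_nth F k * coeff q k)"
    unfolding fps_functional_def fps_act_def poly_sum
    by (simp add: poly_0_coeff_0 coeff_higher_pderiv mult_ac flip: pochhammer_fact)
  also have "\<dots> = (\<Sum>k\<le>N. fact k * fps_nth F k * coeff q k)"
    using assms by (intro sum.mono_neutral_left) (auto simp: coeff_eq_0)
  finally show ?thesis .
qed

lemma fps_functional_eq_deriv_sum:
  assumes "degree q \<le> N"
  shows "fps_functional F q = (\<Sum>k\<le>N. fps_nth F k * poly ((pderiv ^^ k) q) 0)"
  unfolding fps_functional_eq_coeff_sum[OF assms]
  by (simp add: poly_0_coeff_0 coeff_higher_pderiv mult_ac flip: pochhammer_fact)

lemma fps_functional_const_mult:
  "fps_functional (fps_const c * F) q = c * fps_functional F q"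
  by (simp add: fps_functional_eq_coeff_sum[OF order.refl] sum_distrib_left mult_ac)

lemma fps_functional_sum:
  "fps_functional (\<Sum>i\<in>I. F i) q = (\<Sum>i\<in>I. fps_functional (F i) q)"
  unfolding fps_functional_eq_coeff_sum[OF order.refl] fps_sum_nth
  by (subst sum.swap) (simp add: sum_distrib_left sum_distrib_right)

text \<open>The coefficient \<open>c ^ k / fact k\<close> cancels the \<open>fact k\<close> of the
  pairing, which leaves the value of \<open>q\<close>. Identities between exponential series thus
  become identities between values of polynomials.\<close>

lemma fps_functional_exp: "fps_functional (fps_exp c) q = poly q c"
  by (simp add: fps_functional_eq_coeff_sum[OF order.refl] poly_altdef mult_ac)

lemma fps_functional_eq_0:
  assumes "\<And>i. i \<le> degree q \<Longrightarrow> fps_nth F i = 0"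
  shows "fps_functional F q = 0"
  by (simp add: fps_functional_eq_coeff_sum[OF order.refl] assms)

text \<open>Rescaling \<open>t\<close> to \<open>c t\<close> in the Stirling generating function
  multiplies the coefficient of index \<open>l\<close> by \<open>c ^ l\<close>. Since
  \<open>Stirling l k = 0\<close> for \<open>l < k\<close>, the series has order at least
  \<open>k\<close>.\<close>

lemma fps_exp_minus_one_power_nth:
  fixes c :: complex
  shows "fps_nth ((fps_exp c - 1) ^ k) l = fact k * of_nat (Stirling l k) / fact l * c ^ l"
proof -
  have "fps_exp c - 1 = fps_compose (fps_exp 1 - 1) (fps_const c * fps_X)"
    by (simp add: fps_eq_iff fps_nth_compose_linear)
  hence "(fps_exp c - 1) ^ k = fps_compose ((fps_exp 1 - 1) ^ k) (fps_const c * fps_X)"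
    by (simp add: fps_compose_power)
  moreover have "fps_nth ((fps_exp 1 - 1) ^ k) l =
      fact k * of_nat (Stirling l k) / (fact l :: complex)"
    using arg_cong[OF Stirling_generating_function[of k], of "\<lambda>F. fps_nth F l"]
    by (simp add: field_simps)
  ultimately show ?thesis
    by (simp add: fps_nth_compose_linear)
qed

text \<open>Each term of the binomial expansion is a multiple of an exponential series, hence of an
  evaluation functional.\<close>

lemma fps_functional_exp_minus_one_power:
  "fps_functional ((fps_exp c - 1) ^ k) q =
     (\<Sum>j=0..k. of_nat (k choose j) * (-1) ^ (k - j) * poly q (of_nat j * c))"
proof -
  have "fps_exp c - 1 = fps_exp c + fps_const (-1)"
    by (simp add: fps_eq_iff)
  hence "(fps_exp c - 1) ^ k = (fps_exp c + fps_const (-1)) ^ k"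
    by (rule arg_cong)
  also have "\<dots> = (\<Sum>j\<le>k. fps_const (of_nat (k choose j) * (-1) ^ (k - j)) * fps_exp (of_nat j * c))"
    unfolding binomial_ring
    by (simp only: fps_exp_power_mult fps_const_power fps_of_nat[symmetric]
        fps_const_mult[symmetric] mult_ac)
  finally show ?thesis
    by (simp add: fps_functional_sum fps_functional_const_mult fps_functional_exp atMost_atLeast0)
qed

lemma poly_Newton_expansion:
  assumes "degree q \<le> n"
  shows "poly q (of_nat m * c) =
    (\<Sum>k=0..n. of_nat (m choose k) * fps_functional ((fps_exp c - 1) ^ k) q)"
proof -
  let ?g = "\<lambda>k. of_nat (m choose k) * fps_functional ((fps_exp c - 1) ^ k) q"
  have vanish: "fps_functional ((fps_exp c - 1) ^ k) q = 0" if "n < k" for k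
    using assms that
    by (intro fps_functional_eq_0) (simp add: fps_exp_minus_one_power_nth)
  have "fps_exp (of_nat m * c) = ((fps_exp c - 1) + 1) ^ m"
    by (simp add: fps_exp_power_mult)
  also have "\<dots> = (\<Sum>k\<le>m. fps_const (of_nat (m choose k)) * (fps_exp c - 1) ^ k)"
    unfolding binomial_ring by (simp flip: fps_of_nat)
  finally have "poly q (of_nat m * c) = (\<Sum>k\<le>m. ?g k)"
    by (simp add: fps_functional_sum fps_functional_const_mult flip: fps_functional_exp)
  \<comment> \<open>Neither of \<open>m\<close> and \<open>n\<close> need bound the other, so the
    range is first extended to their maximum: terms beyond \<open>m\<close> have binomial
    coefficient 0, and those beyond \<open>n\<close> are 0 by \<open>vanish\<close>.\<close>
  also have "\<dots> = (\<Sum>k\<le>max m n. ?g k)"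
    by (intro sum.mono_neutral_left) auto
  also have "\<dots> = (\<Sum>k=0..n. ?g k)"
    by (intro sum.mono_neutral_right) (auto simp: vanish)
  finally show ?thesis .
qed

text \<open>For nonzero \<open>c\<close> the multiples are distinct, so a nonzero difference would
  have infinitely many roots.\<close>

lemma poly_eq_if_eq_at_multiples:
  fixes c :: complex
  assumes "c \<noteq> 0" and "\<And>m. poly q (of_nat m * c) = poly r (of_nat m * c)"
  shows "q = r"
proof (rule ccontr)
  assume "q \<noteq> r"
  hence "finite {x. poly (q - r) x = 0}"
    by (intro poly_roots_finite) simp
  moreover have "range (\<lambda>m. of_nat m * c) \<subseteq> {x. poly (q - r) x = 0}"
    using assms(2) by auto
  moreover have "inj (\<lambda>m. of_nat m * c)"
    using assms(1) by (simp add: inj_on_def)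
  ultimately show False
    by (meson finite_subset range_inj_infinite)
qed

lemma poly_Delta_tilde: "poly (Delta_tilde q) x = poly q (x + 1) + poly q x"
  by (simp add: Delta_tilde_def poly_shift_poly)

lemma degree_Delta_tilde_le: "degree (Delta_tilde q) \<le> degree q"
  unfolding Delta_tilde_def shift_poly_def by (intro degree_add_le) (simp_all add: degree_pcompose)

text \<open>A shift of the argument keeps degree and leading coefficient, so both summands
  contribute equally.\<close>

lemma coeff_Delta_tilde_degree: "coeff (Delta_tilde q) (degree q) = 2 * lead_coeff q"
proof -
  have "lead_coeff (q \<circ>\<^sub>p [:1, 1:]) = lead_coeff q"
    by (subst lead_coeff_comp) simp_all
  thus ?thesis
    by (simp add: Delta_tilde_def shift_poly_def degree_pcompose)
qed

lemma Delta_tilde_diff: "Delta_tilde (q - r) = Delta_tilde q - Delta_tilde r"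
  by (simp add: Delta_tilde_def shift_poly_def pcompose_diff)

lemma inj_Delta_tilde: "inj Delta_tilde"
proof (rule injI)
  fix q r assume "Delta_tilde q = Delta_tilde r"
  hence "Delta_tilde (q - r) = 0"
    by (simp add: Delta_tilde_diff)
  hence "lead_coeff (q - r) = 0"
    using coeff_Delta_tilde_degree[of "q - r"] by simp
  hence "q - r = 0"
    by (simp only: leading_coeff_0_iff)
  thus "q = r"
    by simp
qed

lemma higher_pderiv_shift_poly: "(pderiv ^^ k) (shift_poly y q) = shift_poly y ((pderiv ^^ k) q)"
  by (induction k) (simp_all add: shift_poly_def pderiv_pcompose pderiv_pCons)

lemma degenerate_exp_add: "degenerate_exp lam (x + y) = degenerate_exp lam x * degenerate_exp lam y"
  by (simp add: degenerate_exp_def fps_compose_mult_distrib add_divide_distrib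
      fps_binomial_add_mult)

text \<open>Passing from \<open>x\<close> to \<open>x + 1\<close> multiplies the generating function
  by \<open>degenerate_exp lam 1\<close>. Adding the unshifted series therefore cancels the
  denominator.\<close>

lemma poly_Delta_tilde_degenerate_Euler:
  "poly (Delta_tilde (degenerate_Euler k lam)) x =
     2 * fact k * of_real lam ^ k * ((x / of_real lam) gchoose k)"
proof -
  let ?g = "degenerate_exp lam 1 + 1"
  \<comment> \<open>The constant term is 2, so \<open>?g\<close> is a unit and the quotient is
    multiplication by its inverse.\<close>
  have "fps_nth ?g 0 \<noteq> 0"
    by (simp add: degenerate_exp_nth)
  hence "2 / ?g * ?g = 2"
    by (simp add: fps_divide_unit mult.assoc inverse_mult_eq_1)
  moreover have "degenerate_Euler_fps lam (x + 1) + degenerate_Euler_fps lam x =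
      (2 / ?g * ?g) * degenerate_exp lam x"
    by (simp add: degenerate_Euler_fps_def degenerate_exp_add algebra_simps)
  ultimately have "degenerate_Euler_fps lam (x + 1) + degenerate_Euler_fps lam x =
      fps_const 2 * degenerate_exp lam x"
    by (simp add: numeral_fps_const)
  hence "fps_nth (degenerate_Euler_fps lam (x + 1)) k + fps_nth (degenerate_Euler_fps lam x) k =
      2 * fps_nth (degenerate_exp lam x) k"
    by (metis fps_add_nth fps_mult_left_const_nth)
  thus ?thesis
    by (simp add: poly_Delta_tilde poly_degenerate_Euler degenerate_exp_nth flip: distrib_left)
qed

lemma degenerate_Euler_expansion:
  assumes "lam \<noteq> 0" and "degree p \<le> n"
  shows "p = (\<Sum>k=0..n. smult (1 / (2 * fact k * of_real lam ^ k) *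
    fps_functional ((fps_exp (of_real lam) - 1) ^ k) (Delta_tilde p)) (degenerate_Euler k lam))"
    (is "p = (\<Sum>k=0..n. smult (?a k) _)")
proof -
  let ?r = "\<Sum>k=0..n. smult (?a k) (degenerate_Euler k lam)"
  have "Delta_tilde p = Delta_tilde ?r"
  proof (rule poly_eq_if_eq_at_multiples[where c = "of_real lam"])
    fix m
    have "poly (Delta_tilde ?r) (of_nat m * of_real lam) =
        (\<Sum>k=0..n. ?a k * poly (Delta_tilde (degenerate_Euler k lam)) (of_nat m * of_real lam))"
      by (simp add: poly_Delta_tilde poly_sum distrib_left sum.distrib)
    \<comment> \<open>The factor \<open>2 * fact k * of_real lam ^ k\<close> cancels against
      \<open>?a k\<close>, and at these points the generalized binomial coefficient is an ordinary
      one.\<close>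
    also have "\<dots> = (\<Sum>k=0..n. of_nat (m choose k) *
        fps_functional ((fps_exp (of_real lam) - 1) ^ k) (Delta_tilde p))"
      using assms(1) by (simp add: poly_Delta_tilde_degenerate_Euler binomial_gbinomial mult.commute)
    also have "\<dots> = poly (Delta_tilde p) (of_nat m * of_real lam)"
      using degree_Delta_tilde_le[of p] assms(2) by (intro poly_Newton_expansion[symmetric]) simp
    finally show "poly (Delta_tilde p) (of_nat m * of_real lam) =
        poly (Delta_tilde ?r) (of_nat m * of_real lam)" ..
  qed (use assms(1) in simp)
  thus ?thesis
    by (rule injD[OF inj_Delta_tilde])
qed

lemma poly_Delta_0:
  "poly (Delta lam k q) 0 = fps_functional ((fps_exp (of_real lam) - 1) ^ k) q"
  by (simp add: Delta_def fps_functional_exp_minus_one_power poly_sum poly_shift_poly)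

lemma fps_functional_exp_minus_one_power_Stirling:
  fixes c :: complex
  assumes "c \<noteq> 0" and "degree q \<le> n"
  shows "fps_functional ((fps_exp c - 1) ^ k) q =
    fact k * c ^ k *
      (\<Sum>l=k..n. of_nat (Stirling l k) * (c ^ (l - k) / fact l) * poly ((pderiv ^^ l) q) 0)"
proof -
  have "fps_functional ((fps_exp c - 1) ^ k) q =
      (\<Sum>l\<le>n. fact k * of_nat (Stirling l k) / fact l * c ^ l * poly ((pderiv ^^ l) q) 0)"
    by (simp add: fps_functional_eq_deriv_sum[OF assms(2)] fps_exp_minus_one_power_nth)
  also have "\<dots> =
      (\<Sum>l=k..n. fact k * of_nat (Stirling l k) / fact l * c ^ l * poly ((pderiv ^^ l) q) 0)"
    by (intro sum.mono_neutral_right) auto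
  \<comment> \<open>The factor pulled out is the one by which the coefficients of the expansion are
    divided. On this range \<open>l - k\<close> is a true difference.\<close>
  also have "\<dots> = (\<Sum>l=k..n. fact k * c ^ k *
      (of_nat (Stirling l k) * (c ^ (l - k) / fact l) * poly ((pderiv ^^ l) q) 0))"
    using assms(1) by (intro sum.cong) (auto simp: power_diff)
  finally show ?thesis
    by (simp add: sum_distrib_left)
qed

theorem theorem3p2:
  fixes lam :: real and p :: "complex poly" and n :: nat and f :: "complex fps"
  assumes "lam \<noteq> 0"
    and "degree p = n"
    and "f = fps_const (1 / of_real lam) * (fps_exp (of_real lam) - 1)"
  shows "\<exists>a :: nat \<Rightarrow> complex.
    p = (\<Sum>k=0..n. smult (a k) (degenerate_Euler k lam)) \<and>
    (\<forall>k\<in>{0..n}.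
      a k = 1 / (2 * fact k) * poly (fps_act (f ^ k) (shift_poly 1 p + p)) 0 \<and>
      a k = 1 / (2 * fact k * of_real lam ^ k) *
              fps_functional ((fps_exp (of_real lam) - 1) ^ k) (shift_poly 1 p + p) \<and>
      a k = 1 / (2 * fact k * of_real lam ^ k) * poly (Delta lam k (Delta_tilde p)) 0 \<and>
      a k = 1 / (2 * fact k * of_real lam ^ k) *
              (\<Sum>j=0..k. of_nat (k choose j) * (-1) ^ (k - j) *
                 (poly p (1 + of_nat j * of_real lam) + poly p (of_nat j * of_real lam))) \<and>
      a k = 1 / 2 *
              (\<Sum>l=k..n. of_nat (Stirling l k) * (of_real lam ^ (l - k) / fact l) *
                 (poly ((pderiv ^^ l) p) 1 + poly ((pderiv ^^ l) p) 0)))"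
proof -
  define c :: complex where "c = of_real lam"
  have c: "c \<noteq> 0"
    using assms(1) by (simp add: c_def)
  define q where "q = shift_poly 1 p + p"
  have q: "Delta_tilde p = q"
    by (simp add: q_def Delta_tilde_def)
  have degree_q: "degree q \<le> n"
    using degree_Delta_tilde_le[of p] assms(2) by (simp add: q)
  \<comment> \<open>This form serves as the definition because each of the other formulas evaluates
    or rescales the same functional.\<close>
  define a where "a k = 1 / (2 * fact k * c ^ k) * fps_functional ((fps_exp c - 1) ^ k) q" for k
  have expansion: "p = (\<Sum>k=0..n. smult (a k) (degenerate_Euler k lam))"
    using degenerate_Euler_expansion[of lam p n] assms(1,2) by (simp add: a_def c_def q)
  have act: "a k = 1 / (2 * fact k) * poly (fps_act (f ^ k) q) 0" for k
  proof -
    have "f ^ k = fps_const (1 / c ^ k) * (fps_exp c - 1) ^ k"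
      by (simp add: assms(3) c_def power_mult_distrib fps_const_power power_one_over)
    thus ?thesis
      by (simp add: a_def fps_functional_const_mult flip: fps_functional_def)
  qed
  have Delta: "a k = 1 / (2 * fact k * c ^ k) * poly (Delta lam k (Delta_tilde p)) 0" for k
    by (simp add: a_def poly_Delta_0 q c_def)
  have points: "a k = 1 / (2 * fact k * c ^ k) *
      (\<Sum>j=0..k. of_nat (k choose j) * (-1) ^ (k - j) *
        (poly p (1 + of_nat j * c) + poly p (of_nat j * c)))" for k
    by (simp add: a_def fps_functional_exp_minus_one_power q_def poly_shift_poly add.commute)
  have derivs: "a k = 1 / 2 *
      (\<Sum>l=k..n. of_nat (Stirling l k) * (c ^ (l - k) / fact l) *
        (poly ((pderiv ^^ l) p) 1 + poly ((pderiv ^^ l) p) 0))" for k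
  proof -
    \<comment> \<open>Derivatives commute with the shift, so the shifted summand contributes the
      value at 1.\<close>
    have "poly ((pderiv ^^ l) q) 0 = poly ((pderiv ^^ l) p) 1 + poly ((pderiv ^^ l) p) 0" for l
      by (simp add: q_def higher_pderiv_add higher_pderiv_shift_poly poly_shift_poly)
    thus ?thesis
      using c by (simp add: a_def fps_functional_exp_minus_one_power_Stirling[OF c degree_q])
  qed
  show ?thesis
    unfolding c_def[symmetric] q_def[symmetric]
    by (intro exI[of _ a] conjI ballI) (rule expansion act a_def Delta points derivs)+
qed

end
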